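(* For each integer $N\ge 2$ let $\{A_{ij}\}_{1\le i<j\le N}$ be independent with $A_{ij}\sim\operatorname{Bernoulli}(P_{ij})$, where the $P_{ij}=P_{ij}^{(N)}$ satisfy $1/N^2\le P_{ij}\le 1-1/N^2$ for all $N$ and all $i<j$. Let $K=K_N\ge1$ be a sequence of integers, and let $M=M_N=\sum_{i<j}P_{ij}$. Suppose that $K=\mathcal O(N^{1/2})$ and that, for some $\delta>0$, $M=\omega\big(N(\log N)^{3+\delta}\big)$. Then $$\max_{z\in\{1,\dots,K\}^N}\big|L(A;z)-\bar L_P(z)\big|=o_P(M)\qquad (N\to\infty).$$
   Context: For $z\in\{1,\dots,K\}^N$ and symmetric $\theta\in[0,1]^{K\times K}$, $$L(A;z,\theta)=\sum_{i<j}\{A_{ij}\log\theta_{z_iz_j}+(1-A_{ij})\log(1-\theta_{z_iz_j})\},\quad \bar L_P(z,\theta)=\sum_{i<j}\{P_{ij}\log\theta_{z_iz_j}+(1-P_{ij})\log(1-\theta_{z_iz_j})\},$$ with $0\log0=0$; $L(A;z)=\sup_\theta L(A;z,\theta)$ and $\bar L_P(z)=\sup_\theta\bar L_P(z,\theta)$, the suprema being over symmetric $\theta\in[0,1]^{K\times K}$. $M=\omega(f(N))$ means $M/f(N)\to\infty$. $X_N=o_P(M)$ means $X_N/M\to0$ in probability. *)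

theory Defs
  imports "HOL-Probability.Probability"
begin

text \<open>
  HOL's real logarithm satisfies ln 0 = 0, so the log-likelihood is built in the extended reals
  with log 0 = -\<open>\<infinity>\<close>.  The convention 0 log 0 = 0 is then the library's
  0 * (-\<open>\<infinity>\<close>) = 0 for extended reals.
\<close>

definition elog :: "real \<Rightarrow> ereal" where
  "elog t = (if t = 0 then -\<infinity> else ereal (ln t))"

definition sym_params :: "nat \<Rightarrow> (nat \<Rightarrow> nat \<Rightarrow> real) set" where
  "sym_params K = {\<theta>. \<forall>a\<in>{1..K}. \<forall>b\<in>{1..K}. 0 \<le> \<theta> a b \<and> \<theta> a b \<le> 1 \<and> \<theta> a b = \<theta> b a}"

definition upper_pairs :: "nat \<Rightarrow> (nat \<times> nat) set" where
  "upper_pairs N = {(i, j). 1 \<le> i \<and> i < j \<and> j \<le> N}"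

text \<open>
  With W the adjacency matrix A this is L(A; z, \<open>\<theta>\<close>); with W = P it is the population
  version.  Only the entries W i j with i < j are used.
\<close>

definition loglik ::
    "nat \<Rightarrow> (nat \<Rightarrow> nat \<Rightarrow> real) \<Rightarrow> (nat \<Rightarrow> nat) \<Rightarrow> (nat \<Rightarrow> nat \<Rightarrow> real) \<Rightarrow> ereal" where
  "loglik N W z \<theta> =
     (\<Sum>(i, j)\<in>upper_pairs N.
        ereal (W i j) * elog (\<theta> (z i) (z j)) + ereal (1 - W i j) * elog (1 - \<theta> (z i) (z j)))"

text \<open>
  The supremum is finite whenever W has entries in [0,1] (lemma \<open>ereal_profile_loglik\<close>), so
  passing to the reals loses nothing.
\<close>

definition profile_loglik ::
    "nat \<Rightarrow> nat \<Rightarrow> (nat \<Rightarrow> nat \<Rightarrow> real) \<Rightarrow> (nat \<Rightarrow> nat) \<Rightarrow> real" where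
  "profile_loglik N K W z = real_of_ereal (SUP \<theta>\<in>sym_params K. loglik N W z \<theta>)"

definition labelings :: "nat \<Rightarrow> nat \<Rightarrow> (nat \<Rightarrow> nat) set" where
  "labelings N K = {1..N} \<rightarrow>\<^sub>E {1..K}"

text \<open>
  X N / M N tends to 0 in probability; the N-th variable lives on its own space.  Measurability is
  part of the definition because HOL assigns measure 0 to non-measurable sets.
\<close>

definition small_oP ::
    "(nat \<Rightarrow> 'a measure) \<Rightarrow> (nat \<Rightarrow> 'a \<Rightarrow> real) \<Rightarrow> (nat \<Rightarrow> real) \<Rightarrow> bool" where
  "small_oP \<Omega> X M \<longleftrightarrow>
     (\<forall>\<^sub>F N in sequentially. X N \<in> borel_measurable (\<Omega> N)) \<and>
     (\<forall>\<epsilon>>0. (\<lambda>N. measure (\<Omega> N) {\<omega> \<in> space (\<Omega> N). \<bar>X N \<omega> / M N\<bar> > \<epsilon>}) \<longlonglongrightarrow> 0)"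

lemma ereal_profile_loglik:
  assumes W: "\<And>i j. 1 \<le> i \<Longrightarrow> i < j \<Longrightarrow> j \<le> N \<Longrightarrow> 0 \<le> W i j \<and> W i j \<le> 1"
    and z: "z \<in> labelings N K"
  shows "ereal (profile_loglik N K W z) = (SUP \<theta>\<in>sym_params K. loglik N W z \<theta>)"
proof -
  have elog_nonpos: "elog t \<le> 0" if "0 \<le> t" "t \<le> 1" for t
    using that by (auto simp: elog_def)
  have upper: "loglik N W z \<theta> \<le> 0" if \<theta>: "\<theta> \<in> sym_params K" for \<theta>
    unfolding loglik_def
  proof (rule sum_nonpos, clarify)
    fix i j assume "(i, j) \<in> upper_pairs N"
    then have ij: "1 \<le> i" "i < j" "j \<le> N" by (auto simp: upper_pairs_def)
    then have "z i \<in> {1..K}" "z j \<in> {1..K}"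
      using z by (auto simp: labelings_def PiE_iff)
    then have t: "0 \<le> \<theta> (z i) (z j)" "\<theta> (z i) (z j) \<le> 1"
      using \<theta> unfolding sym_params_def by blast+
    have "ereal (W i j) * elog (\<theta> (z i) (z j)) \<le> 0"
      using W[OF ij] elog_nonpos[OF t] by (simp add: ereal_mult_le_0_iff)
    moreover have "ereal (1 - W i j) * elog (1 - \<theta> (z i) (z j)) \<le> 0"
      using W[OF ij] elog_nonpos[of "1 - \<theta> (z i) (z j)"] t by (simp add: ereal_mult_le_0_iff)
    ultimately show "ereal (W i j) * elog (\<theta> (z i) (z j)) +
        ereal (1 - W i j) * elog (1 - \<theta> (z i) (z j)) \<le> 0"
      using add_mono by fastforce
  qed
  define h :: "nat \<Rightarrow> nat \<Rightarrow> real" where "h = (\<lambda>_ _. 1/2)"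
  have h: "h \<in> sym_params K" by (auto simp: h_def sym_params_def)
  have "loglik N W z h =
      ereal (\<Sum>(i, j)\<in>upper_pairs N. W i j * ln (1/2) + (1 - W i j) * ln (1/2))"
    by (simp add: loglik_def h_def elog_def split_beta)
  then have "loglik N W z h \<noteq> -\<infinity>" by simp
  moreover have "loglik N W z h \<le> (SUP \<theta>\<in>sym_params K. loglik N W z \<theta>)"
    by (rule SUP_upper[OF h])
  moreover have "(SUP \<theta>\<in>sym_params K. loglik N W z \<theta>) \<le> 0"
    by (rule SUP_least[OF upper])
  ultimately have "\<bar>SUP \<theta>\<in>sym_params K. loglik N W z \<theta>\<bar> \<noteq> \<infinity>" by auto
  then show ?thesis unfolding profile_loglik_def by (rule ereal_real')
qed

end

theory Submission
  imports Defs
begin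

text \<open>
  For a fixed labelling \<open>z\<close> both suprema are attained at the block means of the weights
  (\<open>profile_loglik_eq_block_mean\<close>), so the labelling enters only through the partition of the
  vertex pairs into at most \<open>K\<^sup>2\<close> blocks.  Let \<open>a\<close> and \<open>m\<close> be the block means of \<open>A\<close> and \<open>P\<close>.
  The difference of the two maxima splits as
  \<open>[L(A;z,a) - L(A;z,m)] + [L(A;z,m) - L\<^sub>P(z,m)]\<close>.

  The first bracket is nonnegative.  For any fixed parameter \<open>t\<close> the likelihood ratio of \<open>t\<close>
  against \<open>m\<close> has expectation at most 1: by independence and \<open>1 + x \<le> exp x\<close> it is at most the
  exponential of a sum in which every \<open>P\<close> may be replaced by its block mean, and that sum is then
  at most 0 (\<open>expectation_likelihood_ratio_le_1\<close>).  The vector \<open>a\<close> lies in a grid of at most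
  \<open>(N\<^sup>2 + 1)^(K\<^sup>2)\<close> points, so summing over the grid and applying Markov's inequality bounds the
  bracket (\<open>prob_empirical_maximum_gain\<close>).  The second bracket is a sum of independent centred
  variables with weights bounded by \<open>ln (N\<^sup>2)\<close>, because \<open>m\<close> lies between \<open>1/N\<^sup>2\<close> and \<open>1 - 1/N\<^sup>2\<close>;
  a Chernoff bound whose variance is controlled by \<open>M\<close> applies (\<open>prob_weighted_sum_tail_bound\<close>).

  At deviation \<open>\<epsilon> M\<close> the tails are of order \<open>exp (- c M)\<close> up to the grid size, and
  \<open>exp (- c M / (ln N)\<^sup>2)\<close>.  Since \<open>K = O(\<surd>N)\<close>, the grid size and the number \<open>K ^ N\<close> of labellings
  are both \<open>exp (O(N ln N))\<close>, which the tails beat as soon as \<open>M / (N (ln N)\<^sup>3)\<close> tends to infinity.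
\<close>

section \<open>Block averages and the profile likelihood\<close>

text \<open>
  The mean of the weights \<open>w\<close> over the block of \<open>S\<close> with label \<open>b\<close>.  The vertex pairs are the
  elements of \<open>S\<close>, and \<open>\<kappa> s\<close> is the block that contains \<open>s\<close>.  The mean of an empty block is 0, but
  only labels of the form \<open>\<kappa> s\<close> with \<open>s\<close> in \<open>S\<close> matter below.
\<close>

definition block_mean :: "'s set \<Rightarrow> ('s \<Rightarrow> 'b) \<Rightarrow> ('s \<Rightarrow> real) \<Rightarrow> 'b \<Rightarrow> real" where
  "block_mean S \<kappa> w b = (\<Sum>s | s \<in> S \<and> \<kappa> s = b. w s) / real (card {s \<in> S. \<kappa> s = b})"

text \<open>
  The log-likelihood of a block-constant parameter \<open>t\<close>, over the reals.  The library value
  \<open>ln 0 = 0\<close> makes it differ from the extended-real log-likelihood only where the latter is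
  \<open>-\<infinity>\<close>.
\<close>

definition block_loglik :: "'s set \<Rightarrow> ('s \<Rightarrow> 'b) \<Rightarrow> ('s \<Rightarrow> real) \<Rightarrow> ('b \<Rightarrow> real) \<Rightarrow> real" where
  "block_loglik S \<kappa> w t = (\<Sum>s\<in>S. w s * ln (t (\<kappa> s)) + (1 - w s) * ln (1 - t (\<kappa> s)))"

lemma sum_block_mean:
  assumes "finite S"
  shows "(\<Sum>s\<in>S. w s * g (\<kappa> s)) = (\<Sum>s\<in>S. block_mean S \<kappa> w (\<kappa> s) * g (\<kappa> s))"
proof -
  have block: "(\<Sum>s | s \<in> S \<and> \<kappa> s = b. w s * g (\<kappa> s)) =
      (\<Sum>s | s \<in> S \<and> \<kappa> s = b. block_mean S \<kappa> w (\<kappa> s) * g (\<kappa> s))" if b: "b \<in> \<kappa> ` S" for b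
  proof -
    have "card {s \<in> S. \<kappa> s = b} \<noteq> 0"
      using assms b by auto
    moreover have "(\<Sum>s | s \<in> S \<and> \<kappa> s = b. w s * g (\<kappa> s)) = (\<Sum>s | s \<in> S \<and> \<kappa> s = b. w s) * g b"
      by (simp add: sum_distrib_right)
    moreover have "(\<Sum>s | s \<in> S \<and> \<kappa> s = b. block_mean S \<kappa> w (\<kappa> s) * g (\<kappa> s)) =
        real (card {s \<in> S. \<kappa> s = b}) * (block_mean S \<kappa> w b * g b)"
      by simp
    ultimately show ?thesis by (simp add: block_mean_def)
  qed
  show ?thesis
    unfolding sum.image_gen[OF assms, of _ \<kappa>] by (intro sum.cong refl block)
qed

lemma block_mean_bounds:
  assumes "finite S" "s \<in> S" and w: "\<And>s. s \<in> S \<Longrightarrow> l \<le> w s \<and> w s \<le> u"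
  shows "l \<le> block_mean S \<kappa> w (\<kappa> s)" "block_mean S \<kappa> w (\<kappa> s) \<le> u"
proof -
  let ?B = "{r \<in> S. \<kappa> r = \<kappa> s}"
  have c: "real (card ?B) > 0"
    using assms by (auto simp: card_gt_0_iff)
  have "real (card ?B) * l \<le> (\<Sum>s\<in>?B. w s)"
    by (rule sum_bounded_below) (use w in auto)
  then show "l \<le> block_mean S \<kappa> w (\<kappa> s)"
    unfolding block_mean_def using c by (simp add: field_simps)
  have "(\<Sum>s\<in>?B. w s) \<le> real (card ?B) * u"
    by (rule sum_bounded_above) (use w in auto)
  then show "block_mean S \<kappa> w (\<kappa> s) \<le> u"
    unfolding block_mean_def using c by (simp add: field_simps)
qed

lemma block_mean_pos:
  assumes "finite S" "s \<in> S" "\<And>s. s \<in> S \<Longrightarrow> 0 \<le> w s" "w s \<noteq> 0"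
  shows "0 < block_mean S \<kappa> w (\<kappa> s)"
proof -
  have "0 < (\<Sum>r | r \<in> S \<and> \<kappa> r = \<kappa> s. w r)"
    by (rule sum_pos2[of _ s]) (use assms in \<open>auto simp: less_le\<close>)
  moreover have "card {r \<in> S. \<kappa> r = \<kappa> s} > 0"
    using assms by (auto simp: card_gt_0_iff)
  ultimately show ?thesis by (simp add: block_mean_def)
qed

lemma block_mean_less_1:
  assumes "finite S" "s \<in> S" "\<And>s. s \<in> S \<Longrightarrow> w s \<le> 1" "w s \<noteq> 1"
  shows "block_mean S \<kappa> w (\<kappa> s) < 1"
proof -
  have "(\<Sum>r | r \<in> S \<and> \<kappa> r = \<kappa> s. w r) < (\<Sum>r | r \<in> S \<and> \<kappa> r = \<kappa> s. 1)"
    by (rule sum_strict_mono_ex1) (use assms in \<open>auto simp: less_le intro!: bexI[of _ s]\<close>)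
  moreover have "card {r \<in> S. \<kappa> r = \<kappa> s} > 0"
    using assms by (auto simp: card_gt_0_iff)
  ultimately show ?thesis by (simp add: block_mean_def)
qed

text \<open>
  This inequality is used twice: through \<open>ln x \<le> x - 1\<close> it shows that the block means maximise the
  likelihood, and through \<open>1 + x \<le> exp x\<close> it shows that likelihood ratios against the population
  maximiser have expectation at most 1.
\<close>

lemma sum_block_ratio_le_0:
  assumes fin: "finite S" and w: "\<And>s. s \<in> S \<Longrightarrow> 0 \<le> w s \<and> w s \<le> 1"
    and t: "\<And>s. s \<in> S \<Longrightarrow> 0 \<le> t (\<kappa> s) \<and> t (\<kappa> s) \<le> 1"
  defines "m \<equiv> block_mean S \<kappa> w"
  shows "(\<Sum>s\<in>S. w s * (t (\<kappa> s) / m (\<kappa> s) - 1) +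
            (1 - w s) * ((1 - t (\<kappa> s)) / (1 - m (\<kappa> s)) - 1)) \<le> 0"
proof -
  define f where "f b = t b / m b - 1" for b
  define g where "g b = (1 - t b) / (1 - m b) - 1" for b
  have "(\<Sum>s\<in>S. w s * f (\<kappa> s) + (1 - w s) * g (\<kappa> s)) =
      (\<Sum>s\<in>S. w s * (f (\<kappa> s) - g (\<kappa> s))) + (\<Sum>s\<in>S. g (\<kappa> s))"
    by (simp add: sum.distrib[symmetric] algebra_simps)
  also have "(\<Sum>s\<in>S. w s * (f (\<kappa> s) - g (\<kappa> s))) = (\<Sum>s\<in>S. m (\<kappa> s) * (f (\<kappa> s) - g (\<kappa> s)))"
    unfolding m_def by (rule sum_block_mean[OF fin, where g = "\<lambda>b. f b - g b"])
  also have "\<dots> + (\<Sum>s\<in>S. g (\<kappa> s)) = (\<Sum>s\<in>S. m (\<kappa> s) * f (\<kappa> s) + (1 - m (\<kappa> s)) * g (\<kappa> s))"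
    by (simp add: sum.distrib[symmetric] algebra_simps)
  also have "\<dots> \<le> 0"
  proof (rule sum_nonpos)
    fix s assume s: "s \<in> S"
    have m: "0 \<le> m (\<kappa> s)" "m (\<kappa> s) \<le> 1"
      using block_mean_bounds[OF fin s w] by (auto simp: m_def)
    have "x * (y / x - 1) \<le> y - x" if "0 \<le> y" for x y :: real
      using that by (cases "x = 0") (auto simp: field_simps)
    from this[of "t (\<kappa> s)" "m (\<kappa> s)"] this[of "1 - t (\<kappa> s)" "1 - m (\<kappa> s)"]
    show "m (\<kappa> s) * f (\<kappa> s) + (1 - m (\<kappa> s)) * g (\<kappa> s) \<le> 0"
      using t[OF s] by (simp add: f_def g_def)
  qed
  finally show ?thesis by (simp add: f_def g_def)
qed

lemma block_loglik_le_block_mean: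
  assumes fin: "finite S" and w: "\<And>s. s \<in> S \<Longrightarrow> 0 \<le> w s \<and> w s \<le> 1"
    and t: "\<And>s. s \<in> S \<Longrightarrow> 0 \<le> t (\<kappa> s) \<and> t (\<kappa> s) \<le> 1"
    and t_pos: "\<And>s. s \<in> S \<Longrightarrow> w s \<noteq> 0 \<Longrightarrow> 0 < t (\<kappa> s)"
    and t_less_1: "\<And>s. s \<in> S \<Longrightarrow> w s \<noteq> 1 \<Longrightarrow> t (\<kappa> s) < 1"
  shows "block_loglik S \<kappa> w t \<le> block_loglik S \<kappa> w (block_mean S \<kappa> w)"
proof -
  let ?m = "block_mean S \<kappa> w"
  have ln_ratio: "a * (ln y - ln x) \<le> a * (y / x - 1)"
    if "0 \<le> a" "a \<noteq> 0 \<Longrightarrow> 0 < x" "a \<noteq> 0 \<Longrightarrow> 0 < y" for a x y :: real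
  proof (cases "a = 0")
    case False
    then have "ln (y / x) \<le> y / x - 1" using that by (intro ln_le_minus_one) simp
    then show ?thesis using False that by (intro mult_left_mono) (simp_all add: ln_div)
  qed simp
  have "block_loglik S \<kappa> w t - block_loglik S \<kappa> w ?m =
      (\<Sum>s\<in>S. w s * (ln (t (\<kappa> s)) - ln (?m (\<kappa> s))) +
              (1 - w s) * (ln (1 - t (\<kappa> s)) - ln (1 - ?m (\<kappa> s))))"
    unfolding block_loglik_def sum_subtractf[symmetric] by (simp add: algebra_simps)
  also have "\<dots> \<le> (\<Sum>s\<in>S. w s * (t (\<kappa> s) / ?m (\<kappa> s) - 1) +
              (1 - w s) * ((1 - t (\<kappa> s)) / (1 - ?m (\<kappa> s)) - 1))"
    using w t_pos t_less_1 block_mean_pos[OF fin, of _ w \<kappa>] block_mean_less_1[OF fin, of _ w \<kappa>]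
    by (intro sum_mono add_mono ln_ratio) auto
  also have "\<dots> \<le> 0" by (rule sum_block_ratio_le_0[where t = t, OF fin w t])
  finally show ?thesis by simp
qed

lemma finite_upper_pairs [simp]: "finite (upper_pairs N)"
  by (rule finite_subset[of _ "{1..N} \<times> {1..N}"]) (auto simp: upper_pairs_def)

lemma card_upper_pairs_le: "card (upper_pairs N) \<le> N\<^sup>2"
proof -
  have "card (upper_pairs N) \<le> card ({1..N} \<times> {1..N})"
    by (rule card_mono) (auto simp: upper_pairs_def)
  then show ?thesis by (simp add: card_cartesian_product power2_eq_square)
qed

text \<open>
  The block of a vertex pair is the unordered pair of the labels of its ends, so that a parameter
  on blocks is automatically symmetric.
\<close>

definition pair_block :: "(nat \<Rightarrow> nat) \<Rightarrow> nat \<times> nat \<Rightarrow> nat set" where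
  "pair_block z s = {z (fst s), z (snd s)}"

lemma card_pair_blocks_le:
  assumes "z \<in> labelings N K"
  shows "card (pair_block z ` upper_pairs N) \<le> K\<^sup>2"
proof -
  have "pair_block z ` upper_pairs N \<subseteq> (\<lambda>(a, b). {a, b}) ` ({1..K} \<times> {1..K})"
  proof (rule image_subsetI)
    fix s assume "s \<in> upper_pairs N"
    then have "z (fst s) \<in> {1..K}" "z (snd s) \<in> {1..K}"
      using assms by (auto simp: upper_pairs_def labelings_def PiE_iff)
    then show "pair_block z s \<in> (\<lambda>(a, b). {a, b}) ` ({1..K} \<times> {1..K})"
      by (intro image_eqI[of _ _ "(z (fst s), z (snd s))"]) (auto simp: pair_block_def)
  qed
  then have "card (pair_block z ` upper_pairs N) \<le> card ({1..K} \<times> {1..K})"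
    by (rule surj_card_le[rotated]) simp
  then show ?thesis by (simp add: card_cartesian_product power2_eq_square)
qed

lemma profile_loglik_eq_block_mean:
  assumes W: "\<And>s. s \<in> upper_pairs N \<Longrightarrow> 0 \<le> case_prod W s \<and> case_prod W s \<le> 1"
    and z: "z \<in> labelings N K"
  defines "\<kappa> \<equiv> pair_block z" and "S \<equiv> upper_pairs N" and "w \<equiv> case_prod W"
  shows "profile_loglik N K W z = block_loglik S \<kappa> w (block_mean S \<kappa> w)"
proof -
  have fin: "finite S" by (simp add: S_def)
  have w: "0 \<le> w s \<and> w s \<le> 1" if "s \<in> S" for s
    using W that by (simp add: w_def S_def)
  define ctr where "ctr s x = ereal (w s) * elog x + ereal (1 - w s) * elog (1 - x)" for s x
  have loglik: "loglik N W z \<theta> = (\<Sum>s\<in>S. ctr s (\<theta> (z (fst s)) (z (snd s))))" for \<theta>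
    by (simp add: loglik_def ctr_def S_def w_def split_beta)
  have ctr_real: "ctr s x = ereal (w s * ln x + (1 - w s) * ln (1 - x))"
    if "w s \<noteq> 0 \<Longrightarrow> x \<noteq> 0" "w s \<noteq> 1 \<Longrightarrow> x \<noteq> 1" for s x
    using that by (auto simp: ctr_def elog_def)
  have ctr_infty: "ctr s x = -\<infinity>"
    if "s \<in> S" "0 \<le> x" "x \<le> 1" "(w s \<noteq> 0 \<and> x = 0) \<or> (w s \<noteq> 1 \<and> x = 1)" for s x
    using that w[OF that(1)] by (auto simp: ctr_def elog_def)
  have ctr_not_infty: "ctr s x \<noteq> \<infinity>" if "s \<in> S" "0 \<le> x" "x \<le> 1" for s x
    using that ctr_real[of s x] ctr_infty[of s x] by force
  let ?m = "block_mean S \<kappa> w"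
  have "(SUP \<theta>\<in>sym_params K. loglik N W z \<theta>) = ereal (block_loglik S \<kappa> w ?m)"
  proof (rule antisym)
    show "(SUP \<theta>\<in>sym_params K. loglik N W z \<theta>) \<le> ereal (block_loglik S \<kappa> w ?m)"
    proof (rule SUP_least)
      fix \<theta> assume \<theta>: "\<theta> \<in> sym_params K"
      let ?x = "\<lambda>s. \<theta> (z (fst s)) (z (snd s))"
      have lab: "z (fst s) \<in> {1..K}" "z (snd s) \<in> {1..K}" if "s \<in> S" for s
        using z that by (auto simp: upper_pairs_def labelings_def PiE_iff S_def)
      have bounds: "0 \<le> ?x s" "?x s \<le> 1" if "s \<in> S" for s
        using \<theta> lab[OF that] unfolding sym_params_def by blast+
      \<comment> \<open>By symmetry of \<open>\<theta>\<close> the order in which the two labels of a block are read is irrelevant.\<close>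
      define t where "t b = \<theta> (Min b) (Max b)" for b
      have t: "t (\<kappa> s) = ?x s" if "s \<in> S" for s
      proof -
        have "?x s = \<theta> (z (snd s)) (z (fst s))"
          using \<theta> lab[OF that] unfolding sym_params_def by blast
        then show ?thesis
          by (auto simp: t_def \<kappa>_def pair_block_def min_def max_def)
      qed
      show "loglik N W z \<theta> \<le> ereal (block_loglik S \<kappa> w ?m)"
      proof (cases "\<exists>s\<in>S. ctr s (?x s) = -\<infinity>")
        case True
        then have "\<bar>\<Sum>s\<in>S. ctr s (?x s)\<bar> = \<infinity>"
          using fin by (subst sum_Inf) force
        moreover have "(\<Sum>s\<in>S. ctr s (?x s)) \<noteq> \<infinity>"
          using ctr_not_infty bounds by (subst sum_Pinfty) blast
        ultimately have "(\<Sum>s\<in>S. ctr s (?x s)) = -\<infinity>" by auto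
        then show ?thesis by (simp add: loglik)
      next
        case False
        then have supp: "(w s \<noteq> 0 \<longrightarrow> ?x s \<noteq> 0) \<and> (w s \<noteq> 1 \<longrightarrow> ?x s \<noteq> 1)" if "s \<in> S" for s
          using ctr_infty that bounds by blast
        have "loglik N W z \<theta> = (\<Sum>s\<in>S. ereal (w s * ln (?x s) + (1 - w s) * ln (1 - ?x s)))"
          unfolding loglik using supp by (intro sum.cong refl ctr_real) auto
        also have "\<dots> = ereal (block_loglik S \<kappa> w t)"
          unfolding block_loglik_def sum_ereal using t by simp
        also have "block_loglik S \<kappa> w t \<le> block_loglik S \<kappa> w ?m"
          using supp bounds t
          by (intro block_loglik_le_block_mean fin w) (auto simp: less_le)
        finally show ?thesis by simp
      qed
    qed
  next
    \<comment> \<open>Blocks without any vertex pair get the parameter 0, which is admissible.\<close>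
    define \<theta> where "\<theta> a b = ?m {a, b}" for a b
    have "0 \<le> ?m b \<and> ?m b \<le> 1" for b
    proof (cases "b \<in> \<kappa> ` S")
      case True
      then show ?thesis using block_mean_bounds[where w = w and \<kappa> = \<kappa>, OF fin _ w] by blast
    next
      case False
      then have empty: "{s \<in> S. \<kappa> s = b} = {}" by blast
      show ?thesis unfolding block_mean_def empty by simp
    qed
    then have "\<theta> \<in> sym_params K"
      by (auto simp: sym_params_def \<theta>_def insert_commute)
    then have "loglik N W z \<theta> \<le> (SUP \<theta>\<in>sym_params K. loglik N W z \<theta>)"
      by (rule SUP_upper)
    moreover have "loglik N W z \<theta> =
        (\<Sum>s\<in>S. ereal (w s * ln (?m (\<kappa> s)) + (1 - w s) * ln (1 - ?m (\<kappa> s))))"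
      unfolding loglik
    proof (rule sum.cong)
      fix s assume s: "s \<in> S"
      have "ctr s (?m (\<kappa> s)) = ereal (w s * ln (?m (\<kappa> s)) + (1 - w s) * ln (1 - ?m (\<kappa> s)))"
        using block_mean_pos[OF fin s, of w \<kappa>] block_mean_less_1[OF fin s, of w \<kappa>] w
        by (intro ctr_real) fastforce+
      then show "ctr s (\<theta> (z (fst s)) (z (snd s))) =
          ereal (w s * ln (?m (\<kappa> s)) + (1 - w s) * ln (1 - ?m (\<kappa> s)))"
        by (simp add: \<theta>_def \<kappa>_def pair_block_def)
    qed simp
    ultimately show "ereal (block_loglik S \<kappa> w ?m) \<le> (SUP \<theta>\<in>sym_params K. loglik N W z \<theta>)"
      by (simp add: block_loglik_def)
  qed
  then show ?thesis by (simp add: profile_loglik_def)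
qed

section \<open>Tail bounds for one labelling\<close>

text \<open>Independent Bernoulli variables \<open>X s\<close> with means \<open>p s\<close>, bounded away from 0 and 1 by \<open>q\<close>.\<close>

locale bernoulli_family = prob_space \<Omega> for \<Omega> :: "'a measure" +
  fixes S :: "'s set" and X :: "'s \<Rightarrow> 'a \<Rightarrow> bool" and p :: "'s \<Rightarrow> real" and q :: real
  assumes fin: "finite S"
    and indep: "indep_vars (\<lambda>_. count_space UNIV) X S"
    and distr: "\<And>s. s \<in> S \<Longrightarrow> distr \<Omega> (count_space UNIV) (X s) = measure_pmf (bernoulli_pmf (p s))"
    and q_pos: "0 < q"
    and p_bounds: "\<And>s. s \<in> S \<Longrightarrow> q \<le> p s \<and> p s \<le> 1 - q"
begin

lemma p_01: "s \<in> S \<Longrightarrow> 0 \<le> p s \<and> p s \<le> 1"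
  using p_bounds[of s] q_pos by linarith

lemma X_measurable: "s \<in> S \<Longrightarrow> X s \<in> measurable \<Omega> (count_space UNIV)"
  using indep unfolding indep_vars_def by auto

text \<open>The numerical value of the outcome, in the role of the weights \<open>w\<close>.\<close>

abbreviation edge :: "'a \<Rightarrow> 's \<Rightarrow> real" where
  "edge \<omega> \<equiv> \<lambda>s. of_bool (X s \<omega>)"

lemma edge_measurable: "s \<in> S \<Longrightarrow> (\<lambda>\<omega>. edge \<omega> s) \<in> borel_measurable \<Omega>"
  by (rule measurable_compose[OF X_measurable]) simp_all

lemma block_mean_edge_measurable:
  "(\<lambda>\<omega>. block_mean S \<kappa> (edge \<omega>) b) \<in> borel_measurable \<Omega>"
  unfolding block_mean_def
  by (intro borel_measurable_divide borel_measurable_sum borel_measurable_const edge_measurable) simp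

lemma block_loglik_edge_measurable:
  assumes "\<And>b. (\<lambda>\<omega>. t \<omega> b) \<in> borel_measurable \<Omega>"
  shows "(\<lambda>\<omega>. block_loglik S \<kappa> (edge \<omega>) (t \<omega>)) \<in> borel_measurable \<Omega>"
  unfolding block_loglik_def
  by (intro borel_measurable_sum borel_measurable_add borel_measurable_times borel_measurable_ln
        borel_measurable_diff borel_measurable_const edge_measurable assms)

lemma expectation_prod:
  fixes f :: "'s \<Rightarrow> bool \<Rightarrow> real"
  shows "integrable \<Omega> (\<lambda>\<omega>. \<Prod>s\<in>S. f s (X s \<omega>))"
    and "expectation (\<lambda>\<omega>. \<Prod>s\<in>S. f s (X s \<omega>)) = (\<Prod>s\<in>S. p s * f s True + (1 - p s) * f s False)"
proof -
  have ind: "indep_vars (\<lambda>_. borel) (\<lambda>s \<omega>. f s (X s \<omega>)) S"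
    by (rule indep_vars_compose2[OF indep]) simp
  have int: "integrable \<Omega> (\<lambda>\<omega>. f s (X s \<omega>))" if "s \<in> S" for s
  proof (rule integrable_const_bound)
    show "AE \<omega> in \<Omega>. norm (f s (X s \<omega>)) \<le> max (norm (f s True)) (norm (f s False))"
      by (rule AE_I2) (metis (full_types) max.cobounded1 max.cobounded2)
  qed (rule measurable_compose[OF X_measurable[OF that]], simp)
  have "expectation (\<lambda>\<omega>. f s (X s \<omega>)) = p s * f s True + (1 - p s) * f s False" if s: "s \<in> S" for s
  proof -
    have "expectation (\<lambda>\<omega>. f s (X s \<omega>)) = (\<integral>b. f s b \<partial>distr \<Omega> (count_space UNIV) (X s))"
      by (rule integral_distr[symmetric]) (use X_measurable s in auto)
    then show ?thesis using p_01[OF s] by (simp add: distr[OF s])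
  qed
  then show "expectation (\<lambda>\<omega>. \<Prod>s\<in>S. f s (X s \<omega>)) = (\<Prod>s\<in>S. p s * f s True + (1 - p s) * f s False)"
    using indep_vars_lebesgue_integral[OF fin ind int] by simp
  show "integrable \<Omega> (\<lambda>\<omega>. \<Prod>s\<in>S. f s (X s \<omega>))"
    by (rule indep_vars_integrable[OF fin ind int])
qed

lemma prob_exp_tail:
  assumes int: "integrable \<Omega> Y" and Y: "\<And>\<omega>. 0 \<le> Y \<omega>" and E: "expectation Y \<le> c"
    and Z: "Z \<in> borel_measurable \<Omega>" and le: "\<And>\<omega>. exp (Z \<omega>) \<le> Y \<omega>"
  shows "prob {\<omega> \<in> space \<Omega>. Z \<omega> > a} \<le> c * exp (- a)"
proof -
  have "prob {\<omega> \<in> space \<Omega>. Z \<omega> > a} \<le> prob {\<omega> \<in> space \<Omega>. Y \<omega> \<ge> exp a}"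
  proof (rule finite_measure_mono)
    show "{\<omega> \<in> space \<Omega>. Z \<omega> > a} \<subseteq> {\<omega> \<in> space \<Omega>. Y \<omega> \<ge> exp a}"
      using le by (auto intro: order_trans[OF less_imp_le])
    show "{\<omega> \<in> space \<Omega>. Y \<omega> \<ge> exp a} \<in> events"
      using borel_measurable_integrable[OF int] by measurable
  qed
  also have "\<dots> \<le> expectation Y / exp a"
    using int Y by (intro integral_Markov_inequality_measure[where A = "{}"]) auto
  also have "\<dots> \<le> c * exp (- a)"
    using E by (simp add: exp_minus divide_inverse mult_right_mono)
  finally show ?thesis .
qed

text \<open>
  For a fixed parameter \<open>t\<close> the likelihood ratio against the population maximiser has expectation
  at most 1, even though the variables need not follow a blockmodel.
\<close>

lemma expectation_likelihood_ratio_le_1: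
  assumes t: "\<And>s. s \<in> S \<Longrightarrow> 0 \<le> t (\<kappa> s) \<and> t (\<kappa> s) \<le> 1"
  defines "m \<equiv> block_mean S \<kappa> p"
  defines "R \<equiv> \<lambda>\<omega>. \<Prod>s\<in>S. if X s \<omega> then t (\<kappa> s) / m (\<kappa> s) else (1 - t (\<kappa> s)) / (1 - m (\<kappa> s))"
  shows "integrable \<Omega> R" "expectation R \<le> 1"
proof -
  let ?f = "\<lambda>s b. if b then t (\<kappa> s) / m (\<kappa> s) else (1 - t (\<kappa> s)) / (1 - m (\<kappa> s))"
  show "integrable \<Omega> R" unfolding R_def by (rule expectation_prod(1)[of ?f])
  have "expectation R = (\<Prod>s\<in>S. p s * ?f s True + (1 - p s) * ?f s False)"
    unfolding R_def by (rule expectation_prod(2)[of ?f])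
  also have "\<dots> \<le> (\<Prod>s\<in>S. exp (p s * (t (\<kappa> s) / m (\<kappa> s) - 1) +
      (1 - p s) * ((1 - t (\<kappa> s)) / (1 - m (\<kappa> s)) - 1)))"
  proof (rule prod_mono, rule conjI)
    fix s assume s: "s \<in> S"
    have m: "0 \<le> m (\<kappa> s)" "m (\<kappa> s) \<le> 1"
      using block_mean_bounds[where \<kappa> = \<kappa> and w = p, OF fin s p_01] by (auto simp: m_def)
    show "0 \<le> p s * ?f s True + (1 - p s) * ?f s False"
      using m t[OF s] p_01[OF s] by simp
    have "p s * ?f s True + (1 - p s) * ?f s False =
        1 + (p s * (t (\<kappa> s) / m (\<kappa> s) - 1) + (1 - p s) * ((1 - t (\<kappa> s)) / (1 - m (\<kappa> s)) - 1))"
      by (simp add: algebra_simps)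
    also have "\<dots> \<le> exp (p s * (t (\<kappa> s) / m (\<kappa> s) - 1) +
        (1 - p s) * ((1 - t (\<kappa> s)) / (1 - m (\<kappa> s)) - 1))"
      by (rule exp_ge_add_one_self)
    finally show "p s * ?f s True + (1 - p s) * ?f s False \<le> \<dots>" .
  qed
  also have "\<dots> = exp (\<Sum>s\<in>S. p s * (t (\<kappa> s) / m (\<kappa> s) - 1) +
      (1 - p s) * ((1 - t (\<kappa> s)) / (1 - m (\<kappa> s)) - 1))"
    by (simp add: exp_sum fin)
  also have "\<dots> \<le> 1"
    using sum_block_ratio_le_0[where t = t and \<kappa> = \<kappa>, OF fin p_01 t] by (simp add: m_def)
  finally show "expectation R \<le> 1" .
qed

text \<open>
  The empirical block means take values in a finite grid, so summing the likelihood ratio over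
  the grid bounds the ratio at the empirical maximiser.
\<close>

lemma prob_empirical_maximum_gain:
  fixes \<kappa> :: "'s \<Rightarrow> 'b"
  defines "m \<equiv> block_mean S \<kappa> p"
  shows "prob {\<omega> \<in> space \<Omega>. block_loglik S \<kappa> (edge \<omega>) (block_mean S \<kappa> (edge \<omega>)) -
             block_loglik S \<kappa> (edge \<omega>) m > a}
           \<le> real (card S + 1) ^ card (\<kappa> ` S) * exp (- a)"
proof -
  define G where "G = \<kappa> ` S \<rightarrow>\<^sub>E {0..card S}"
  define n where "n b = card {s \<in> S. \<kappa> s = b}" for b
  \<comment> \<open>The minimum only makes every grid point a parameter; at counts arising from a block it is idle.\<close>
  define T where "T k b = min 1 (real (k b) / real (n b))" for k :: "'b \<Rightarrow> nat" and b
  define R where "R k \<omega> = (\<Prod>s\<in>S. if X s \<omega> then T k (\<kappa> s) / m (\<kappa> s)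
      else (1 - T k (\<kappa> s)) / (1 - m (\<kappa> s)))" for k \<omega>
  have fin_G: "finite G" unfolding G_def by (intro finite_PiE) (use fin in auto)
  have T: "0 \<le> T k b \<and> T k b \<le> 1" for k b by (simp add: T_def)
  have m: "0 < m (\<kappa> s)" "m (\<kappa> s) < 1" if "s \<in> S" for s
    using block_mean_bounds[where \<kappa> = \<kappa> and w = p, OF fin that p_bounds] q_pos by (auto simp: m_def)
  have R_int: "integrable \<Omega> (R k)" and R_exp: "expectation (R k) \<le> 1" for k
    using expectation_likelihood_ratio_le_1[of "T k" \<kappa>] T unfolding R_def[abs_def] m_def by blast+
  have R_nonneg: "0 \<le> R k \<omega>" for k \<omega>
    unfolding R_def using T m by (intro prod_nonneg) (force intro!: divide_nonneg_pos)
  show ?thesis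
  proof (rule prob_exp_tail)
    show "integrable \<Omega> (\<lambda>\<omega>. \<Sum>k\<in>G. R k \<omega>)"
      by (intro Bochner_Integration.integrable_sum R_int)
    show "0 \<le> (\<Sum>k\<in>G. R k \<omega>)" for \<omega> by (intro sum_nonneg R_nonneg)
    have "expectation (\<lambda>\<omega>. \<Sum>k\<in>G. R k \<omega>) = (\<Sum>k\<in>G. expectation (R k))"
      by (rule Bochner_Integration.integral_sum) (rule R_int)
    also have "\<dots> \<le> real (card G) * 1"
      by (rule sum_bounded_above) (rule R_exp)
    also have "card G = (card S + 1) ^ card (\<kappa> ` S)"
      unfolding G_def using fin by (subst card_PiE) auto
    finally show "expectation (\<lambda>\<omega>. \<Sum>k\<in>G. R k \<omega>) \<le> real (card S + 1) ^ card (\<kappa> ` S)"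
      by simp
    show "(\<lambda>\<omega>. block_loglik S \<kappa> (edge \<omega>) (block_mean S \<kappa> (edge \<omega>)) -
        block_loglik S \<kappa> (edge \<omega>) m) \<in> borel_measurable \<Omega>"
      by (intro borel_measurable_diff block_loglik_edge_measurable block_mean_edge_measurable) simp
  next
    fix \<omega>
    let ?h = "block_mean S \<kappa> (edge \<omega>)"
    define k where "k = (\<lambda>b\<in>\<kappa> ` S. card {s \<in> S. \<kappa> s = b \<and> X s \<omega>})"
    have k: "k \<in> G"
      unfolding k_def G_def by (auto intro!: card_mono fin)
    have edge_01: "0 \<le> edge \<omega> s \<and> edge \<omega> s \<le> 1" for s by simp
    have Tk: "T k (\<kappa> s) = ?h (\<kappa> s)" if s: "s \<in> S" for s
    proof -
      have "(\<Sum>r | r \<in> S \<and> \<kappa> r = \<kappa> s. edge \<omega> r) = real (card {r \<in> S. \<kappa> r = \<kappa> s \<and> X r \<omega>})"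
        using fin by (subst sum_of_bool_eq) (auto intro!: arg_cong[where f = card])
      then have "real (k (\<kappa> s)) / real (n (\<kappa> s)) = ?h (\<kappa> s)"
        using s by (simp add: k_def n_def block_mean_def)
      moreover have "?h (\<kappa> s) \<le> 1"
        using block_mean_bounds(2)[OF fin s edge_01] .
      ultimately show ?thesis by (simp add: T_def)
    qed
    have "exp (block_loglik S \<kappa> (edge \<omega>) ?h - block_loglik S \<kappa> (edge \<omega>) m) =
        (\<Prod>s\<in>S. exp (edge \<omega> s * (ln (?h (\<kappa> s)) - ln (m (\<kappa> s))) +
          (1 - edge \<omega> s) * (ln (1 - ?h (\<kappa> s)) - ln (1 - m (\<kappa> s)))))"
      unfolding block_loglik_def sum_subtractf[symmetric] exp_sum[OF fin, symmetric]
      by (simp add: algebra_simps)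
    also have "\<dots> = R k \<omega>"
      unfolding R_def
    proof (rule prod.cong)
      fix s assume s: "s \<in> S"
      show "exp (edge \<omega> s * (ln (?h (\<kappa> s)) - ln (m (\<kappa> s))) +
          (1 - edge \<omega> s) * (ln (1 - ?h (\<kappa> s)) - ln (1 - m (\<kappa> s)))) =
        (if X s \<omega> then T k (\<kappa> s) / m (\<kappa> s) else (1 - T k (\<kappa> s)) / (1 - m (\<kappa> s)))"
        using m[OF s] block_mean_pos[OF fin s, of "edge \<omega>" \<kappa>]
          block_mean_less_1[OF fin s, of "edge \<omega>" \<kappa>]
        by (cases "X s \<omega>") (simp_all add: Tk[OF s] exp_diff)
    qed simp
    also have "\<dots> \<le> (\<Sum>k\<in>G. R k \<omega>)"
      by (rule member_le_sum[OF k]) (use fin_G R_nonneg in auto)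
    finally show "exp (block_loglik S \<kappa> (edge \<omega>) ?h - block_loglik S \<kappa> (edge \<omega>) m)
        \<le> (\<Sum>k\<in>G. R k \<omega>)" .
  qed
qed

end

lemma exp_le_quadratic:
  fixes x :: real
  assumes "\<bar>x\<bar> \<le> 1"
  shows "exp x \<le> 1 + x + x\<^sup>2"
proof (cases "0 \<le> x")
  case True
  then show ?thesis using assms exp_bound[of x] by simp
next
  case False
  have "exp x * (1 - x) \<le> exp x * exp (- x)"
    using exp_ge_add_one_self[of "- x"] by (intro mult_left_mono) auto
  also have "\<dots> = 1" by (simp add: exp_minus)
  also have "1 \<le> 1 - x ^ 3" using False by (simp add: power_less_zero_eq)
  also have "\<dots> = (1 + x + x\<^sup>2) * (1 - x)" by (simp add: power2_eq_square power3_eq_cube algebra_simps)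
  finally show ?thesis using False by (simp add: mult_le_cancel_right)
qed

context bernoulli_family
begin

text \<open>
  The variance proxy involves \<open>p s\<close> rather than a constant, so the bound stays useful for sparse
  graphs, where a bound from the ranges of the summands alone would be too weak.
\<close>

lemma prob_weighted_sum_tail:
  assumes c: "\<And>s. s \<in> S \<Longrightarrow> \<bar>c s\<bar> \<le> 1"
  shows "prob {\<omega> \<in> space \<Omega>. (\<Sum>s\<in>S. (edge \<omega> s - p s) * c s) > a}
           \<le> exp ((\<Sum>s\<in>S. p s * (c s)\<^sup>2)) * exp (- a)"
proof (rule prob_exp_tail)
  let ?f = "\<lambda>s b. exp ((of_bool b - p s) * c s)"
  show "integrable \<Omega> (\<lambda>\<omega>. \<Prod>s\<in>S. ?f s (X s \<omega>))"
    by (rule expectation_prod(1))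
  show "0 \<le> (\<Prod>s\<in>S. ?f s (X s \<omega>))" for \<omega> by (intro prod_nonneg) simp
  show "(\<lambda>\<omega>. \<Sum>s\<in>S. (edge \<omega> s - p s) * c s) \<in> borel_measurable \<Omega>"
    by (intro borel_measurable_sum borel_measurable_times borel_measurable_diff
        borel_measurable_const edge_measurable)
  show "exp (\<Sum>s\<in>S. (edge \<omega> s - p s) * c s) \<le> (\<Prod>s\<in>S. ?f s (X s \<omega>))" for \<omega>
    by (simp add: exp_sum fin)
  have "expectation (\<lambda>\<omega>. \<Prod>s\<in>S. ?f s (X s \<omega>)) = (\<Prod>s\<in>S. p s * ?f s True + (1 - p s) * ?f s False)"
    by (rule expectation_prod(2))
  also have "\<dots> \<le> (\<Prod>s\<in>S. exp (p s * (c s)\<^sup>2))"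
  proof (rule prod_mono, rule conjI)
    fix s assume s: "s \<in> S"
    show "0 \<le> p s * ?f s True + (1 - p s) * ?f s False" using p_01[OF s] by simp
    have "p s * ?f s True + (1 - p s) * ?f s False = exp (- (p s * c s)) * (1 + p s * (exp (c s) - 1))"
      by (simp add: algebra_simps flip: exp_add)
    also have "\<dots> \<le> exp (- (p s * c s)) * (1 + p s * (c s + (c s)\<^sup>2))"
      using exp_le_quadratic[OF c[OF s]] p_01[OF s] by (simp add: mult_left_mono)
    also have "\<dots> \<le> exp (- (p s * c s)) * exp (p s * (c s + (c s)\<^sup>2))"
      by (intro mult_left_mono exp_ge_add_one_self) simp
    also have "\<dots> = exp (p s * (c s)\<^sup>2)"
      by (simp add: algebra_simps flip: exp_add)
    finally show "p s * ?f s True + (1 - p s) * ?f s False \<le> exp (p s * (c s)\<^sup>2)" .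
  qed
  also have "\<dots> = exp (\<Sum>s\<in>S. p s * (c s)\<^sup>2)" by (simp add: exp_sum fin)
  finally show "expectation (\<lambda>\<omega>. \<Prod>s\<in>S. ?f s (X s \<omega>)) \<le> exp (\<Sum>s\<in>S. p s * (c s)\<^sup>2)" .
qed

lemma prob_weighted_sum_tail_bound:
  assumes c: "\<And>s. s \<in> S \<Longrightarrow> \<bar>c s\<bar> \<le> B" and \<epsilon>: "0 < \<epsilon>" "\<epsilon> \<le> 4 * B"
  shows "prob {\<omega> \<in> space \<Omega>. (\<Sum>s\<in>S. (edge \<omega> s - p s) * c s) > \<epsilon> / 2 * sum p S}
           \<le> exp (- (\<epsilon>\<^sup>2 * sum p S / (16 * B\<^sup>2)))"
proof -
  have B: "0 < B" using \<epsilon> by linarith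
  \<comment> \<open>The optimal exponential tilt for variance proxy \<open>2 * B\<^sup>2 * sum p S\<close>, at deviation
      \<open>\<epsilon> / 2 * sum p S\<close>.\<close>
  define l where "l = \<epsilon> / (4 * B\<^sup>2)"
  have l: "0 < l" "l * B \<le> 1" using \<epsilon> B by (auto simp: l_def field_simps power2_eq_square)
  have lc: "\<bar>l * c s\<bar> \<le> l * B" if "s \<in> S" for s
    using c[OF that] l by (simp add: abs_mult)
  have "{\<omega> \<in> space \<Omega>. (\<Sum>s\<in>S. (edge \<omega> s - p s) * c s) > \<epsilon> / 2 * sum p S} =
      {\<omega> \<in> space \<Omega>. (\<Sum>s\<in>S. (edge \<omega> s - p s) * (l * c s)) > l * (\<epsilon> / 2 * sum p S)}"
  proof (intro Collect_cong conj_cong refl)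
    fix \<omega>
    have "(\<Sum>s\<in>S. (edge \<omega> s - p s) * (l * c s)) = l * (\<Sum>s\<in>S. (edge \<omega> s - p s) * c s)"
      unfolding sum_distrib_left by (simp add: algebra_simps)
    then show "(\<Sum>s\<in>S. (edge \<omega> s - p s) * c s) > \<epsilon> / 2 * sum p S \<longleftrightarrow>
        (\<Sum>s\<in>S. (edge \<omega> s - p s) * (l * c s)) > l * (\<epsilon> / 2 * sum p S)"
      using l by simp
  qed
  also have "prob \<dots> \<le> exp (\<Sum>s\<in>S. p s * (l * c s)\<^sup>2) * exp (- (l * (\<epsilon> / 2 * sum p S)))"
    using lc l by (intro prob_weighted_sum_tail) (meson order_trans)
  also have "\<dots> \<le> exp ((l * B)\<^sup>2 * sum p S) * exp (- (l * (\<epsilon> / 2 * sum p S)))"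
  proof -
    have "(\<Sum>s\<in>S. p s * (l * c s)\<^sup>2) \<le> (\<Sum>s\<in>S. p s * (l * B)\<^sup>2)"
    proof (intro sum_mono mult_left_mono)
      fix s assume s: "s \<in> S"
      have "\<bar>l * c s\<bar>\<^sup>2 \<le> (l * B)\<^sup>2" by (rule power_mono[OF lc[OF s]]) simp
      then show "(l * c s)\<^sup>2 \<le> (l * B)\<^sup>2" by simp
    qed (use p_01 in simp)
    then show ?thesis by (simp add: sum_distrib_right mult.commute)
  qed
  also have "\<dots> = exp (- (\<epsilon>\<^sup>2 * sum p S / (16 * B\<^sup>2)))"
    unfolding exp_add[symmetric] exp_inj_iff using B
    by (simp add: l_def field_simps power2_eq_square)
  finally show ?thesis .
qed

text \<open>
  The maximised log-likelihoods differ by the gain \<open>U\<close> of the empirical over the population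
  maximiser, which is nonnegative, plus the fluctuation \<open>V\<close> of the log-likelihood at the
  population maximiser, a weighted sum of the centred variables with logit weights bounded by \<open>B\<close>.
\<close>

lemma prob_block_maximum_deviation:
  fixes \<kappa> :: "'s \<Rightarrow> 'b"
  assumes B: "ln (1 / q) \<le> B" and \<epsilon>: "0 < \<epsilon>" "\<epsilon> \<le> 4 * B"
  defines "m \<equiv> block_mean S \<kappa> p"
  shows "prob {\<omega> \<in> space \<Omega>. \<bar>block_loglik S \<kappa> (edge \<omega>) (block_mean S \<kappa> (edge \<omega>)) -
             block_loglik S \<kappa> p m\<bar> > \<epsilon> * sum p S}
           \<le> real (card S + 1) ^ card (\<kappa> ` S) * exp (- (\<epsilon> / 2 * sum p S)) +
             2 * exp (- (\<epsilon>\<^sup>2 * sum p S / (16 * B\<^sup>2)))"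
proof -
  define c where "c s = ln (m (\<kappa> s)) - ln (1 - m (\<kappa> s))" for s
  have m: "q \<le> m (\<kappa> s)" "m (\<kappa> s) \<le> 1 - q" if "s \<in> S" for s
    using block_mean_bounds[where \<kappa> = \<kappa> and w = p, OF fin that p_bounds] by (auto simp: m_def)
  have c: "\<bar>c s\<bar> \<le> B" if "s \<in> S" for s
  proof -
    have "ln q \<le> ln (m (\<kappa> s))" "ln q \<le> ln (1 - m (\<kappa> s))" "ln (m (\<kappa> s)) \<le> 0" "ln (1 - m (\<kappa> s)) \<le> 0"
      using m[OF that] q_pos by auto
    moreover have "- ln q \<le> B" using B q_pos by (simp add: ln_div)
    ultimately show ?thesis unfolding c_def by linarith
  qed
  define U where "U \<omega> = block_loglik S \<kappa> (edge \<omega>) (block_mean S \<kappa> (edge \<omega>)) -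
      block_loglik S \<kappa> (edge \<omega>) m" for \<omega>
  define V where "V c \<omega> = (\<Sum>s\<in>S. (edge \<omega> s - p s) * c s)" for c \<omega>
  have VU: "block_loglik S \<kappa> (edge \<omega>) (block_mean S \<kappa> (edge \<omega>)) - block_loglik S \<kappa> p m =
      U \<omega> + V c \<omega>" for \<omega>
  proof -
    have "block_loglik S \<kappa> (edge \<omega>) m - block_loglik S \<kappa> p m = V c \<omega>"
      unfolding block_loglik_def V_def c_def sum_subtractf[symmetric]
      by (intro sum.cong refl) (simp add: algebra_simps)
    then show ?thesis by (simp add: U_def)
  qed
  have V_minus: "V (\<lambda>s. - c s) \<omega> = - V c \<omega>" for \<omega> by (simp add: V_def sum_negf)
  have U_nonneg: "0 \<le> U \<omega>" for \<omega>
  proof -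
    have "block_loglik S \<kappa> (edge \<omega>) m \<le> block_loglik S \<kappa> (edge \<omega>) (block_mean S \<kappa> (edge \<omega>))"
      using m q_pos by (intro block_loglik_le_block_mean fin) (fastforce simp: less_le)+
    then show ?thesis by (simp add: U_def)
  qed
  have U_meas: "U \<in> borel_measurable \<Omega>"
    unfolding U_def[abs_def]
    by (intro borel_measurable_diff block_loglik_edge_measurable block_mean_edge_measurable) simp
  have V_meas: "V c \<in> borel_measurable \<Omega>" for c
    unfolding V_def[abs_def]
    by (intro borel_measurable_sum borel_measurable_times borel_measurable_diff
        borel_measurable_const edge_measurable)
  let ?a = "\<epsilon> / 2 * sum p S"
  have sum_p: "0 \<le> sum p S" by (rule sum_nonneg) (use p_01 in auto)
  let ?EU = "{\<omega> \<in> space \<Omega>. U \<omega> > ?a}"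
  let ?EV = "\<lambda>c. {\<omega> \<in> space \<Omega>. V c \<omega> > ?a}"
  have ev: "?EU \<in> events" "?EV c \<in> events" for c
    using U_meas V_meas[of c] by measurable
  have "prob {\<omega> \<in> space \<Omega>. \<bar>U \<omega> + V c \<omega>\<bar> > \<epsilon> * sum p S} \<le>
      prob (?EU \<union> (?EV c \<union> ?EV (\<lambda>s. - c s)))"
  proof (rule finite_measure_mono)
    show "{\<omega> \<in> space \<Omega>. \<bar>U \<omega> + V c \<omega>\<bar> > \<epsilon> * sum p S} \<subseteq> ?EU \<union> (?EV c \<union> ?EV (\<lambda>s. - c s))"
    proof (rule subsetI)
      fix \<omega> assume "\<omega> \<in> {\<omega> \<in> space \<Omega>. \<bar>U \<omega> + V c \<omega>\<bar> > \<epsilon> * sum p S}"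
      moreover have "0 \<le> \<epsilon> * sum p S" using \<epsilon> sum_p by simp
      ultimately show "\<omega> \<in> ?EU \<union> (?EV c \<union> ?EV (\<lambda>s. - c s))"
        using U_nonneg[of \<omega>] by (auto simp: V_minus)
    qed
 qed (use ev in blast)
  also have "\<dots> \<le> prob ?EU + (prob (?EV c) + prob (?EV (\<lambda>s. - c s)))"
    using ev by (intro order_trans[OF measure_Un_le] add_mono order_refl measure_Un_le) auto
  also have "prob ?EU \<le> real (card S + 1) ^ card (\<kappa> ` S) * exp (- ?a)"
    unfolding U_def m_def by (rule prob_empirical_maximum_gain)
  also have "prob (?EV c) \<le> exp (- (\<epsilon>\<^sup>2 * sum p S / (16 * B\<^sup>2)))"
    unfolding V_def by (rule prob_weighted_sum_tail_bound[OF c \<epsilon>])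
  also have "prob (?EV (\<lambda>s. - c s)) \<le> exp (- (\<epsilon>\<^sup>2 * sum p S / (16 * B\<^sup>2)))"
    unfolding V_def by (rule prob_weighted_sum_tail_bound[OF _ \<epsilon>]) (use c in simp)
  finally show ?thesis by (simp add: VU)
qed

end

section \<open>Union over labellings and asymptotics\<close>

lemma prob_max_profile_deviation:
  fixes \<Omega> :: "'a measure" and A :: "nat \<Rightarrow> nat \<Rightarrow> 'a \<Rightarrow> bool" and P :: "nat \<Rightarrow> nat \<Rightarrow> real"
  assumes prob: "prob_space \<Omega>"
    and indep: "prob_space.indep_vars \<Omega> (\<lambda>_. count_space UNIV) (\<lambda>(i, j). A i j) (upper_pairs N)"
    and bernoulli: "\<And>i j. (i, j) \<in> upper_pairs N \<Longrightarrow>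
      distr \<Omega> (count_space UNIV) (A i j) = measure_pmf (bernoulli_pmf (P i j))"
    and P_bounds: "\<And>i j. (i, j) \<in> upper_pairs N \<Longrightarrow>
      1 / real N ^ 2 \<le> P i j \<and> P i j \<le> 1 - 1 / real N ^ 2"
    and N: "2 \<le> N" and K: "1 \<le> K"
  defines "m \<equiv> (\<Sum>(i, j)\<in>upper_pairs N. P i j)"
  defines "D \<equiv> \<lambda>\<omega>. Max ((\<lambda>z. \<bar>profile_loglik N K (\<lambda>i j. of_bool (A i j \<omega>)) z
                              - profile_loglik N K P z\<bar>) ` labelings N K)"
  shows "D \<in> borel_measurable \<Omega>"
    and "0 < \<epsilon> \<Longrightarrow> \<epsilon> \<le> 8 * ln (real N) \<Longrightarrow> 0 < m \<Longrightarrow>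
      measure \<Omega> {\<omega> \<in> space \<Omega>. \<bar>D \<omega> / m\<bar> > \<epsilon>} \<le>
        real K ^ N * (real (N\<^sup>2 + 1) ^ K\<^sup>2 * exp (- (\<epsilon> / 2 * m)) +
          2 * exp (- (\<epsilon>\<^sup>2 * m / (64 * (ln (real N))\<^sup>2))))"
proof -
  define S where "S = upper_pairs N"
  define X where "X = (\<lambda>(i, j). A i j)"
  define p where "p = (\<lambda>(i, j). P i j)"
  interpret bernoulli_family \<Omega> S X p "1 / real N ^ 2"
    unfolding bernoulli_family_def bernoulli_family_axioms_def S_def X_def p_def
    using prob indep bernoulli P_bounds N by auto
  let ?Z = "labelings N K"
  have fin_Z: "finite ?Z" by (auto simp: labelings_def intro: finite_PiE)
  have card_Z: "card ?Z = K ^ N" by (simp add: labelings_def card_PiE)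
  then have Z_nonempty: "?Z \<noteq> {}" using K by auto
  define d where "d z \<omega> = block_loglik S (pair_block z) (edge \<omega>)
      (block_mean S (pair_block z) (edge \<omega>)) -
      block_loglik S (pair_block z) p (block_mean S (pair_block z) p)" for z \<omega>
  have D: "D \<omega> = Max ((\<lambda>z. \<bar>d z \<omega>\<bar>) ` ?Z)" for \<omega>
    unfolding D_def
  proof (intro arg_cong[where f = Max] image_cong refl)
    fix z assume z: "z \<in> ?Z"
    have "case_prod (\<lambda>i j. of_bool (A i j \<omega>)) = edge \<omega>"
      by (auto simp: X_def)
    then have "profile_loglik N K (\<lambda>i j. of_bool (A i j \<omega>)) z =
        block_loglik S (pair_block z) (edge \<omega>) (block_mean S (pair_block z) (edge \<omega>))"
      unfolding S_def by (subst profile_loglik_eq_block_mean[OF _ z]) auto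
    moreover have "profile_loglik N K P z =
        block_loglik S (pair_block z) p (block_mean S (pair_block z) p)"
      unfolding S_def p_def
      by (subst profile_loglik_eq_block_mean[OF _ z]) (use p_01 in \<open>auto simp: S_def p_def\<close>)
    ultimately show "\<bar>profile_loglik N K (\<lambda>i j. of_bool (A i j \<omega>)) z - profile_loglik N K P z\<bar> =
        \<bar>d z \<omega>\<bar>"
      by (simp add: d_def)
  qed
  have d_meas: "d z \<in> borel_measurable \<Omega>" for z
    unfolding d_def[abs_def]
    by (intro borel_measurable_diff borel_measurable_const block_loglik_edge_measurable
        block_mean_edge_measurable)
  show "D \<in> borel_measurable \<Omega>"
    unfolding D[abs_def] by (intro borel_measurable_Max fin_Z borel_measurable_abs d_meas)
  assume \<epsilon>: "0 < \<epsilon>" "\<epsilon> \<le> 8 * ln (real N)" and m_pos: "0 < m"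
  have sum_p: "sum p S = m" by (simp add: m_def p_def S_def)
  let ?bound = "real (N\<^sup>2 + 1) ^ K\<^sup>2 * exp (- (\<epsilon> / 2 * m)) +
      2 * exp (- (\<epsilon>\<^sup>2 * m / (64 * (ln (real N))\<^sup>2)))"
  let ?E = "\<lambda>z. {\<omega> \<in> space \<Omega>. \<bar>d z \<omega>\<bar> > \<epsilon> * m}"
  have E_bound: "prob (?E z) \<le> ?bound" if z: "z \<in> ?Z" for z
  proof -
    have "prob (?E z) \<le> real (card S + 1) ^ card (pair_block z ` S) * exp (- (\<epsilon> / 2 * m)) +
        2 * exp (- (\<epsilon>\<^sup>2 * m / (16 * (2 * ln (real N))\<^sup>2)))"
      unfolding d_def sum_p[symmetric]
      using \<epsilon> N by (intro prob_block_maximum_deviation) (auto simp: ln_realpow)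
    also have "real (card S + 1) ^ card (pair_block z ` S) \<le> real (N\<^sup>2 + 1) ^ K\<^sup>2"
    proof -
      have "real (card S + 1) ^ card (pair_block z ` S) \<le> real (card S + 1) ^ K\<^sup>2"
        using card_pair_blocks_le[OF z] by (intro power_increasing) (auto simp: S_def)
      also have "\<dots> \<le> real (N\<^sup>2 + 1) ^ K\<^sup>2"
        using card_upper_pairs_le[of N]
        by (intro power_mono of_nat_mono) (auto simp: S_def simp del: of_nat_power)
      finally show ?thesis .
    qed
    finally show ?thesis by (simp add: power_mult_distrib mult_right_mono)
  qed
  have E_ev: "?E z \<in> events" for z
    using d_meas[of z] by measurable
  have "measure \<Omega> {\<omega> \<in> space \<Omega>. \<bar>D \<omega> / m\<bar> > \<epsilon>} \<le> prob (\<Union>z\<in>?Z. ?E z)"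
  proof (rule finite_measure_mono)
    show "{\<omega> \<in> space \<Omega>. \<bar>D \<omega> / m\<bar> > \<epsilon>} \<subseteq> (\<Union>z\<in>?Z. ?E z)"
    proof (rule subsetI)
      fix \<omega> assume \<omega>: "\<omega> \<in> {\<omega> \<in> space \<Omega>. \<bar>D \<omega> / m\<bar> > \<epsilon>}"
      have "D \<omega> \<in> (\<lambda>z. \<bar>d z \<omega>\<bar>) ` ?Z"
        unfolding D using fin_Z Z_nonempty by (intro Max_in) auto
      then obtain z where "z \<in> ?Z" "D \<omega> = \<bar>d z \<omega>\<bar>" by blast
      then show "\<omega> \<in> (\<Union>z\<in>?Z. ?E z)"
        using \<omega> m_pos by (auto simp: field_simps)
    qed
  qed (use fin_Z E_ev in auto)
  also have "\<dots> \<le> (\<Sum>z\<in>?Z. prob (?E z))"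
    by (rule finite_measure_subadditive_finite) (use fin_Z E_ev in auto)
  also have "\<dots> \<le> real (card ?Z) * ?bound"
    by (rule sum_bounded_above) (rule E_bound)
  finally show "measure \<Omega> {\<omega> \<in> space \<Omega>. \<bar>D \<omega> / m\<bar> > \<epsilon>} \<le> real K ^ N * ?bound"
    by (simp add: card_Z)
qed

lemma filterlim_ln_real: "filterlim (\<lambda>N::nat. ln (real N)) at_top sequentially"
  by (rule filterlim_compose[OF ln_at_top filterlim_real_sequentially])

lemma eventually_union_bound_le:
  fixes K :: "nat \<Rightarrow> nat" and M :: "nat \<Rightarrow> real"
  assumes K_bigo: "(\<lambda>N. real (K N)) \<in> O(\<lambda>N. real N powr (1 / 2))"
    and M_omega: "filterlim (\<lambda>N. M N / (real N * ln (real N) powr (3 + \<delta>))) at_top sequentially"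
    and \<delta>: "0 < \<delta>" and \<epsilon>: "0 < \<epsilon>"
  shows "\<forall>\<^sub>F N in sequentially. real (K N) ^ N *
      (real (N\<^sup>2 + 1) ^ (K N)\<^sup>2 * exp (- (\<epsilon> / 2 * M N)) +
        2 * exp (- (\<epsilon>\<^sup>2 * M N / (64 * (ln (real N))\<^sup>2)))) \<le> 3 * exp (- (real N * ln (real N)))"
proof -
  obtain C where C: "0 < C" "\<forall>\<^sub>F N in sequentially. real (K N) \<le> C * sqrt (real N)"
    using landau_o.bigE[OF K_bigo] by (auto simp: powr_half_sqrt)
  \<comment> \<open>With \<open>L = N ln N\<close>, there are at most \<open>exp L\<close> labellings and \<open>exp (3 * C\<^sup>2 * L)\<close> grid points,
      and \<open>B\<close> makes the two tails at most \<open>exp (- (2 + 3 * C\<^sup>2) * L)\<close> and \<open>exp (- 2 * L)\<close>.\<close>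
  define B where "B = max (2 * (2 + 3 * C\<^sup>2) / \<epsilon>) (128 / \<epsilon>\<^sup>2)"
  have B: "2 * (2 + 3 * C\<^sup>2) / \<epsilon> \<le> B" "128 / \<epsilon>\<^sup>2 \<le> B" by (simp_all add: B_def)
  have "0 < 128 / \<epsilon>\<^sup>2" using \<epsilon> by simp
  then have B_pos: "0 < B" using B(2) by linarith
  have "\<forall>\<^sub>F N in sequentially. B \<le> M N / (real N * ln (real N) powr (3 + \<delta>))"
    using M_omega by (auto simp: filterlim_at_top)
  moreover have "\<forall>\<^sub>F N in sequentially. C\<^sup>2 \<le> real N"
    using filterlim_real_sequentially by (simp add: filterlim_at_top)
  moreover have "\<forall>\<^sub>F N in sequentially. 1 \<le> ln (real N)"
    using filterlim_ln_real by (simp add: filterlim_at_top)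
  moreover have "\<forall>\<^sub>F N::nat in sequentially. 2 \<le> N"
    by (rule eventually_ge_at_top)
  ultimately show ?thesis using C(2)
  proof eventually_elim
    case (elim N)
    define x where "x = ln (real N)"
    define L where "L = real N * x"
    have x: "1 \<le> x" using elim by (simp add: x_def)
    have N: "0 < real N" using elim by simp
    have L: "0 < L" using x N by (simp add: L_def)
    have "x ^ 3 = x powr 3" using x by simp
    also have "\<dots> \<le> x powr (3 + \<delta>)" using x \<delta> by (intro powr_mono) auto
    finally have "B * (real N * x ^ 3) \<le> B * (real N * x powr (3 + \<delta>))"
      using B_pos N by simp
    also have "\<dots> \<le> M N"
      using elim(1) N x by (simp add: x_def[symmetric] pos_le_divide_eq)
    finally have M3: "B * L * x\<^sup>2 \<le> M N"
      by (simp add: L_def power2_eq_square power3_eq_cube algebra_simps)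
    have "B * L * 1 \<le> B * L * x\<^sup>2"
      using B_pos L x by (intro mult_left_mono) auto
    then have M1: "B * L \<le> M N" using M3 by linarith
    have "(2 + 3 * C\<^sup>2) * L = \<epsilon> / 2 * (2 * (2 + 3 * C\<^sup>2) / \<epsilon> * L)"
      using \<epsilon> by simp
    also have "\<dots> \<le> \<epsilon> / 2 * (B * L)"
      using B L \<epsilon> by (intro mult_left_mono mult_right_mono) auto
    also have "\<dots> \<le> \<epsilon> / 2 * M N"
      using M1 \<epsilon> by (intro mult_left_mono) auto
    finally have e1: "(2 + 3 * C\<^sup>2) * L \<le> \<epsilon> / 2 * M N" .
    have "2 * L = \<epsilon>\<^sup>2 / 64 * (128 / \<epsilon>\<^sup>2 * L)"
      using \<epsilon> by simp
    also have "\<dots> \<le> \<epsilon>\<^sup>2 / 64 * (B * L)"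
      using B L \<epsilon> by (intro mult_left_mono mult_right_mono) auto
    also have "\<dots> \<le> \<epsilon>\<^sup>2 / 64 * (M N / x\<^sup>2)"
      using M3 x \<epsilon> by (intro mult_left_mono) (auto simp: pos_le_divide_eq)
    finally have e2: "2 * L \<le> \<epsilon>\<^sup>2 * M N / (64 * x\<^sup>2)" by simp
    have K2: "(real (K N))\<^sup>2 \<le> C\<^sup>2 * real N"
    proof -
      have "(real (K N))\<^sup>2 \<le> (C * sqrt (real N))\<^sup>2"
        using elim by (intro power_mono) auto
      then show ?thesis by (simp add: power_mult_distrib)
    qed
    also have "\<dots> \<le> (real N)\<^sup>2"
      using elim by (simp add: power2_eq_square)
    finally have KN: "real (K N) \<le> real N" by (rule power2_le_imp_le) simp
    have exp_power: "real N ^ k = exp (real k * x)" for k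
      using N by (simp add: x_def exp_of_nat_mult)
    have k1: "real (K N) ^ N \<le> exp L"
    proof -
      have "real (K N) ^ N \<le> real N ^ N" by (rule power_mono[OF KN]) simp
      then show ?thesis by (simp add: exp_power L_def)
    qed
    have k2: "real (N\<^sup>2 + 1) ^ (K N)\<^sup>2 \<le> exp (3 * C\<^sup>2 * L)"
    proof -
      have "real (N\<^sup>2 + 1) \<le> real N ^ 3"
      proof -
        have "1 \<le> (real N)\<^sup>2" using elim by simp
        then have "real (N\<^sup>2 + 1) \<le> 2 * (real N)\<^sup>2" by simp
        also have "\<dots> \<le> real N * (real N)\<^sup>2" using elim by (intro mult_right_mono) auto
        finally show ?thesis by (simp add: power2_eq_square power3_eq_cube)
      qed
      then have "real (N\<^sup>2 + 1) ^ (K N)\<^sup>2 \<le> (real N ^ 3) ^ (K N)\<^sup>2"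
        by (rule power_mono) simp
      also have "\<dots> = exp (3 * (real (K N))\<^sup>2 * x)"
        by (simp add: exp_power exp_of_nat_mult[symmetric] mult.commute mult.left_commute)
      also have "\<dots> \<le> exp (3 * (C\<^sup>2 * real N) * x)"
        using K2 x by simp
      finally show ?thesis by (simp add: L_def mult.assoc)
    qed
    have "real (K N) ^ N * (real (N\<^sup>2 + 1) ^ (K N)\<^sup>2 * exp (- (\<epsilon> / 2 * M N)) +
        2 * exp (- (\<epsilon>\<^sup>2 * M N / (64 * x\<^sup>2)))) \<le>
      exp L * (exp (3 * C\<^sup>2 * L) * exp (- ((2 + 3 * C\<^sup>2) * L)) + 2 * exp (- (2 * L)))"
      using k1 k2 e1 e2 by (intro mult_mono add_mono) auto
    also have "\<dots> = 3 * exp (- L)"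
    proof -
      have "exp L * (exp (3 * C\<^sup>2 * L) * exp (- ((2 + 3 * C\<^sup>2) * L))) = exp (- L)"
        unfolding exp_add[symmetric] exp_inj_iff by (simp add: algebra_simps)
      moreover have "exp L * exp (- (2 * L)) = exp (- L)"
        unfolding exp_add[symmetric] exp_inj_iff by simp
      ultimately show ?thesis by (simp add: distrib_left mult.left_commute)
    qed
    finally show ?case by (simp add: x_def L_def)
  qed
qed

theorem theorem2:
  fixes \<Omega> :: "nat \<Rightarrow> 'a measure"
    and A :: "nat \<Rightarrow> nat \<Rightarrow> nat \<Rightarrow> 'a \<Rightarrow> bool"
    and P :: "nat \<Rightarrow> nat \<Rightarrow> nat \<Rightarrow> real"
    and K :: "nat \<Rightarrow> nat"
    and M :: "nat \<Rightarrow> real"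
    and \<delta> :: real
  assumes prob: "\<And>N. N \<ge> 2 \<Longrightarrow> prob_space (\<Omega> N)"
    and indep: "\<And>N. N \<ge> 2 \<Longrightarrow>
      prob_space.indep_vars (\<Omega> N) (\<lambda>_. count_space UNIV) (\<lambda>(i, j). A N i j) (upper_pairs N)"
    and bernoulli: "\<And>N i j. N \<ge> 2 \<Longrightarrow> (i, j) \<in> upper_pairs N \<Longrightarrow>
      distr (\<Omega> N) (count_space UNIV) (A N i j) = measure_pmf (bernoulli_pmf (P N i j))"
    and P_bounds: "\<And>N i j. N \<ge> 2 \<Longrightarrow> (i, j) \<in> upper_pairs N \<Longrightarrow>
      1 / real N ^ 2 \<le> P N i j \<and> P N i j \<le> 1 - 1 / real N ^ 2"
    and K_pos: "\<And>N. N \<ge> 2 \<Longrightarrow> K N \<ge> 1"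
    and M_def: "\<And>N. N \<ge> 2 \<Longrightarrow> M N = (\<Sum>(i, j)\<in>upper_pairs N. P N i j)"
    and K_bigo: "(\<lambda>N. real (K N)) \<in> O(\<lambda>N. real N powr (1 / 2))"
    and delta_pos: "\<delta> > 0"
    and M_omega: "filterlim (\<lambda>N. M N / (real N * ln (real N) powr (3 + \<delta>))) at_top sequentially"
  shows "small_oP \<Omega>
    (\<lambda>N \<omega>. Max ((\<lambda>z. \<bar>profile_loglik N (K N) (\<lambda>i j. of_bool (A N i j \<omega>)) z
                      - profile_loglik N (K N) (P N) z\<bar>) ` labelings N (K N)))
    M"
  unfolding small_oP_def
proof (intro conjI allI impI)
  let ?D = "\<lambda>N \<omega>. Max ((\<lambda>z. \<bar>profile_loglik N (K N) (\<lambda>i j. of_bool (A N i j \<omega>)) z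
                      - profile_loglik N (K N) (P N) z\<bar>) ` labelings N (K N))"
  have ev2: "\<forall>\<^sub>F N::nat in sequentially. 2 \<le> N"
    by (rule eventually_ge_at_top)
  then show "\<forall>\<^sub>F N in sequentially. ?D N \<in> borel_measurable (\<Omega> N)"
  proof eventually_elim
    case (elim N)
    show ?case
      by (rule prob_max_profile_deviation(1)[OF prob indep bernoulli P_bounds _ K_pos])
        (use elim in auto)
  qed
  fix \<epsilon> :: real assume \<epsilon>: "0 < \<epsilon>"
  show "(\<lambda>N. measure (\<Omega> N) {\<omega> \<in> space (\<Omega> N). \<bar>?D N \<omega> / M N\<bar> > \<epsilon>}) \<longlonglongrightarrow> 0"
  proof (rule tendsto_sandwich)
    show "\<forall>\<^sub>F N in sequentially. 0 \<le> measure (\<Omega> N) {\<omega> \<in> space (\<Omega> N). \<bar>?D N \<omega> / M N\<bar> > \<epsilon>}"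
      by simp
    have "\<forall>\<^sub>F N in sequentially. \<epsilon> / 8 \<le> ln (real N)"
      using filterlim_ln_real unfolding filterlim_at_top by blast
    then show "\<forall>\<^sub>F N in sequentially.
        measure (\<Omega> N) {\<omega> \<in> space (\<Omega> N). \<bar>?D N \<omega> / M N\<bar> > \<epsilon>} \<le> 3 * exp (- (real N * ln (real N)))"
      using ev2 eventually_union_bound_le[OF K_bigo M_omega delta_pos \<epsilon>]
    proof eventually_elim
      case (elim N)
      have "0 < M N"
        unfolding M_def[OF elim(2)]
      proof (rule sum_pos)
        have "(1, 2) \<in> upper_pairs N" using elim by (simp add: upper_pairs_def)
        then show "upper_pairs N \<noteq> {}" by blast
        fix s assume s: "s \<in> upper_pairs N"
        obtain i j where ij: "s = (i, j)" by fastforce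
        have "0 < 1 / real N ^ 2" using elim by simp
        also have "\<dots> \<le> P N i j" using P_bounds[OF elim(2)] s ij by blast
        finally show "0 < (case s of (i, j) \<Rightarrow> P N i j)" by (simp add: ij)
      qed simp
      then have "measure (\<Omega> N) {\<omega> \<in> space (\<Omega> N). \<bar>?D N \<omega> / M N\<bar> > \<epsilon>} \<le>
          real (K N) ^ N * (real (N\<^sup>2 + 1) ^ (K N)\<^sup>2 * exp (- (\<epsilon> / 2 * M N)) +
            2 * exp (- (\<epsilon>\<^sup>2 * M N / (64 * (ln (real N))\<^sup>2))))"
        unfolding M_def[OF elim(2)]
        by (intro prob_max_profile_deviation(2)[OF prob indep bernoulli P_bounds _ K_pos])
          (use elim \<epsilon> in auto)
      then show ?case using elim(3) by linarith
    qed
    show "(\<lambda>N. 3 * exp (- (real N * ln (real N)))) \<longlonglongrightarrow> 0"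
    proof -
      have "filterlim (\<lambda>N. real N * ln (real N)) at_top sequentially"
        by (rule filterlim_at_top_mult_at_top[OF filterlim_real_sequentially filterlim_ln_real])
      then have "(\<lambda>N. exp (- (real N * ln (real N)))) \<longlonglongrightarrow> 0"
        by (intro filterlim_compose[OF exp_at_bot]) (simp add: filterlim_uminus_at_top)
      then show ?thesis by (rule tendsto_mult_right_zero)
    qed
  qed simp
qed

end
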